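(* Let $I,J$ be finite sets, let $I(j)\subseteq I$ for each $j\in J$, let $f_i\ge 0$ for $i\in I$, $d_j\ge 0$ and $\hat d_j\ge 0$ for $j\in J$, let $0<D\le\sum_{j\in J}d_j$, let $\Gamma$ be an integer with $0\le\Gamma\le|J|$, and for each $i\in I$ let $F_i:\mathbb{R}\to\mathbb{R}_+$ be convex and non-decreasing. Then the robust problem (R) and the extended formulation (E) defined in the context are equivalent: for every $x\in\mathbb{R}_{\ge 0}^{I\times J}$, $y\in\{0,1\}^{I}$, $v\in\mathbb{R}_{\ge 0}^{I}$, the triple $(x,y,v)$ is feasible for (R) if and only if there exist $\tau\ge 0$, $\rho\in\mathbb{R}_{\ge 0}^{I}$, $\pi\in\mathbb{R}_{\ge 0}^{J}$, $\sigma\in\mathbb{R}_{\ge 0}^{I\times J}$ such that $(x,y,v,\tau,\rho,\pi,\sigma)$ is feasible for (E). The two objective functions are the same function of $(y,v)$, so in particular the two problems have the same optimal value and the same optimal $(x,y,v)$.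
   Context: Interpretation: $I$ is the set of potential facilities with opening costs $f_i$; $J$ is the set of customers with nominal demands $d_j$ and maximal demand deviations $\hat d_j$; $I(j)$ is the set of facilities that can cover $j$; $F_i$ is the congestion cost of facility $i$; $D$ is the target coverage; $\Gamma$ bounds the number of demands that deviate. Problem (R): minimize $\sum_{i\in I}f_iy_i+\sum_{i\in I}F_i(v_i)$ over $x\in\mathbb{R}_{\ge0}^{I\times J}$, $y\in\{0,1\}^{I}$, $v\in\mathbb{R}_{\ge0}^{I}$ subject to - $v_i\ge\sum_{j\in J}d_jx_{ij}+\max_{S\subseteq J,\,|S|\le\Gamma}\sum_{j\in S}\hat d_jx_{ij}$ for all $i\in I$; - $\sum_{i\in I}\sum_{j\in J}d_jx_{ij}-\max_{S\subseteq J,\,|S|\le\Gamma}\sum_{i\in I}\sum_{j\in S}\hat d_jx_{ij}\ge D$; - $\sum_{i\in I}x_{ij}\le 1$ for all $j\in J$; - $x_{ij}\le y_i$ for all $j\in J$, $i\in I(j)$. Problem (E): minimize $\sum_{i\in I}f_iy_i+\sum_{i\in I}F_i(v_i)$ over $x\in\mathbb{R}_{\ge0}^{I\times J}$, $y\in\{0,1\}^{I}$, $v\in\mathbb{R}_{\ge0}^{I}$, $\tau\in\mathbb{R}_{\ge0}$, $\rho\in\mathbb{R}_{\ge0}^{I}$, $\pi\in\mathbb{R}_{\ge0}^{J}$, $\sigma\in\mathbb{R}_{\ge0}^{I\times J}$ subject to - $v_i-\sum_{j\in J}d_jx_{ij}-\bigl(\Gamma\rho_i+\sum_{j\in J}\sigma_{ij}\bigr)\ge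 0$ for all $i\in I$; - $\sum_{i\in I}\sum_{j\in J}d_jx_{ij}-\bigl(\Gamma\tau+\sum_{j\in J}\pi_j\bigr)\ge D$; - $\tau+\pi_j\ge\sum_{i\in I}\hat d_jx_{ij}$ for all $j\in J$; - $\rho_i+\sigma_{ij}\ge\hat d_jx_{ij}$ for all $j\in J$, $i\in I$; - $\sum_{i\in I}x_{ij}\le1$ for all $j\in J$; - $x_{ij}\le y_i$ for all $j\in J$, $i\in I(j)$. *)

theory Defs
  imports "HOL-Analysis.Analysis"
begin

text \<open>
  Vectors indexed by finite sets are extensional functions (\<open>\<rightarrow>\<^sub>E\<close>), so the variable
  spaces below are exact copies of the nonnegative orthants and of the binary vectors.
  The parameter \<open>cov j\<close> is the set $I(j)$ of facilities that can cover customer \<open>j\<close>, and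
  \<open>dh\<close> is the vector of maximal demand deviations.  As in the model, the linking constraint
  between \<open>x\<close> and \<open>y\<close> is imposed only for \<open>i \<in> cov j\<close>, while all sums range over the full
  index sets.
\<close>

definition feasible_R ::
  "'i set \<Rightarrow> 'j set \<Rightarrow> ('j \<Rightarrow> 'i set) \<Rightarrow> ('j \<Rightarrow> real) \<Rightarrow> ('j \<Rightarrow> real) \<Rightarrow> real \<Rightarrow> nat \<Rightarrow>
   (('i \<times> 'j \<Rightarrow> real) \<times> ('i \<Rightarrow> real) \<times> ('i \<Rightarrow> real)) set" where
  "feasible_R I J cov d dh D \<Gamma> = {(x, y, v).
     x \<in> I \<times> J \<rightarrow>\<^sub>E {0..} \<and> y \<in> I \<rightarrow>\<^sub>E {0, 1} \<and> v \<in> I \<rightarrow>\<^sub>E {0..} \<and>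
     (\<forall>i\<in>I. v i \<ge> (\<Sum>j\<in>J. d j * x (i, j))
              + (MAX S\<in>{S. S \<subseteq> J \<and> card S \<le> \<Gamma>}. \<Sum>j\<in>S. dh j * x (i, j))) \<and>
     (\<Sum>i\<in>I. \<Sum>j\<in>J. d j * x (i, j))
       - (MAX S\<in>{S. S \<subseteq> J \<and> card S \<le> \<Gamma>}. \<Sum>i\<in>I. \<Sum>j\<in>S. dh j * x (i, j)) \<ge> D \<and>
     (\<forall>j\<in>J. (\<Sum>i\<in>I. x (i, j)) \<le> 1) \<and>
     (\<forall>j\<in>J. \<forall>i\<in>cov j. x (i, j) \<le> y i)}"

definition objective_R ::
  "'i set \<Rightarrow> ('i \<Rightarrow> real) \<Rightarrow> ('i \<Rightarrow> real \<Rightarrow> real) \<Rightarrow>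
   ('i \<times> 'j \<Rightarrow> real) \<times> ('i \<Rightarrow> real) \<times> ('i \<Rightarrow> real) \<Rightarrow> real" where
  "objective_R I f F = (\<lambda>(x, y, v). (\<Sum>i\<in>I. f i * y i) + (\<Sum>i\<in>I. F i (v i)))"

definition feasible_E ::
  "'i set \<Rightarrow> 'j set \<Rightarrow> ('j \<Rightarrow> 'i set) \<Rightarrow> ('j \<Rightarrow> real) \<Rightarrow> ('j \<Rightarrow> real) \<Rightarrow> real \<Rightarrow> nat \<Rightarrow>
   (('i \<times> 'j \<Rightarrow> real) \<times> ('i \<Rightarrow> real) \<times> ('i \<Rightarrow> real) \<times>
    real \<times> ('i \<Rightarrow> real) \<times> ('j \<Rightarrow> real) \<times> ('i \<times> 'j \<Rightarrow> real)) set" where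
  "feasible_E I J cov d dh D \<Gamma> = {(x, y, v, \<tau>, \<rho>, \<pi>, \<sigma>).
     x \<in> I \<times> J \<rightarrow>\<^sub>E {0..} \<and> y \<in> I \<rightarrow>\<^sub>E {0, 1} \<and> v \<in> I \<rightarrow>\<^sub>E {0..} \<and>
     \<tau> \<ge> 0 \<and> \<rho> \<in> I \<rightarrow>\<^sub>E {0..} \<and> \<pi> \<in> J \<rightarrow>\<^sub>E {0..} \<and> \<sigma> \<in> I \<times> J \<rightarrow>\<^sub>E {0..} \<and>
     (\<forall>i\<in>I. v i - (\<Sum>j\<in>J. d j * x (i, j)) - (real \<Gamma> * \<rho> i + (\<Sum>j\<in>J. \<sigma> (i, j))) \<ge> 0) \<and>
     (\<Sum>i\<in>I. \<Sum>j\<in>J. d j * x (i, j)) - (real \<Gamma> * \<tau> + (\<Sum>j\<in>J. \<pi> j)) \<ge> D \<and>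
     (\<forall>j\<in>J. \<tau> + \<pi> j \<ge> (\<Sum>i\<in>I. dh j * x (i, j))) \<and>
     (\<forall>j\<in>J. \<forall>i\<in>I. \<rho> i + \<sigma> (i, j) \<ge> dh j * x (i, j)) \<and>
     (\<forall>j\<in>J. (\<Sum>i\<in>I. x (i, j)) \<le> 1) \<and>
     (\<forall>j\<in>J. \<forall>i\<in>cov j. x (i, j) \<le> y i)}"

definition objective_E ::
  "'i set \<Rightarrow> ('i \<Rightarrow> real) \<Rightarrow> ('i \<Rightarrow> real \<Rightarrow> real) \<Rightarrow>
   ('i \<times> 'j \<Rightarrow> real) \<times> ('i \<Rightarrow> real) \<times> ('i \<Rightarrow> real) \<times>
     real \<times> ('i \<Rightarrow> real) \<times> ('j \<Rightarrow> real) \<times> ('i \<times> 'j \<Rightarrow> real) \<Rightarrow> real" where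
  "objective_E I f F =
     (\<lambda>(x, y, v, \<tau>, \<rho>, \<pi>, \<sigma>). (\<Sum>i\<in>I. f i * y i) + (\<Sum>i\<in>I. F i (v i)))"

text \<open>
  The optimal value is an infimum in the extended reals: it need not be attained a priori,
  and it is \<open>\<infinity>\<close> for an infeasible problem.
\<close>

definition optimal_value :: "('a \<Rightarrow> real) \<Rightarrow> 'a set \<Rightarrow> ereal" where
  "optimal_value obj X = (INF z\<in>X. ereal (obj z))"

end

theory Submission
  imports Defs
begin

text \<open>
  Both nonlinear terms of (R) have the same shape: the largest total of at most \<open>\<Gamma>\<close> of
  finitely many nonnegative numbers \<open>a j\<close>.  As a linear program this quantity is
  \<open>max {\<Sum>j. a j * z j | 0 \<le> z j \<le> 1, \<Sum>j. z j \<le> \<Gamma>}\<close>, and its dual is to minimise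
  \<open>\<Gamma> * t + \<Sum>j. p j\<close> over \<open>t, p \<ge> 0\<close> with \<open>t + p j \<ge> a j\<close>.  So the maximum is at most \<open>b\<close>
  exactly when some dual solution has value at most \<open>b\<close> (lemma \<open>Max_sum_le_iff_dual\<close>), which
  allows each maximum to be replaced by dual variables as extra unknowns of the problem.

  Strong duality needs no linear programming here, since the optimal dual solution is explicit.
  When there are more than \<open>\<Gamma>\<close> indices, choose \<open>S\<close> to be \<open>\<Gamma>\<close> of them carrying
  the largest values, let \<open>t\<close> be the largest value outside \<open>S\<close>, and let \<open>p j\<close> be the excess of \<open>a j\<close> over \<open>t\<close>.
  The excess vanishes outside \<open>S\<close>, and the total over \<open>S\<close> is \<open>\<Gamma> * t\<close> plus the total excess.
  Otherwise \<open>S\<close> is everything and \<open>t = 0\<close>.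

  Applying this to \<open>a j = dh j * x (i, j)\<close> for each facility \<open>i\<close> yields \<open>\<rho> i\<close> and \<open>\<sigma> (i, j)\<close>,
  and applying it to \<open>a j = \<Sum>i\<in>I. dh j * x (i, j)\<close> yields \<open>\<tau>\<close> and \<open>\<pi>\<close>.  Thus (R) is the
  image of (E) under the projection to \<open>(x, y, v)\<close>.  The objective does not see the forgotten
  coordinates, so minimising over (E) and over its image is the same task.
\<close>

text \<open>
  Weak duality: \<open>a j \<le> t + p j\<close> is summed over \<open>S\<close>, where \<open>t\<close> occurs at most \<open>\<Gamma>\<close> times.
\<close>

lemma sum_le_dual:
  fixes a p :: "'j \<Rightarrow> real" and t :: real
  assumes "finite J" "S \<subseteq> J" "card S \<le> \<Gamma>" "0 \<le> t"
    and p: "\<And>j. j \<in> J \<Longrightarrow> 0 \<le> p j"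
    and cover: "\<And>j. j \<in> J \<Longrightarrow> a j \<le> t + p j"
  shows "sum a S \<le> real \<Gamma> * t + sum p J"
proof -
  have "sum a S \<le> (\<Sum>j\<in>S. t + p j)"
    using assms by (intro sum_mono) auto
  also have "\<dots> = real (card S) * t + sum p S"
    by (simp add: sum.distrib)
  also have "\<dots> \<le> real \<Gamma> * t + sum p J"
    using assms by (intro add_mono mult_right_mono sum_mono2) auto
  finally show ?thesis .
qed

lemma ex_largest_values_subset:
  fixes a :: "'j \<Rightarrow> 'a :: linorder"
  assumes "finite J" "k \<le> card J"
  obtains S where "S \<subseteq> J" "card S = k" "\<And>i j. i \<in> S \<Longrightarrow> j \<in> J - S \<Longrightarrow> a j \<le> a i"
proof -
  from assms(2) have "\<exists>S\<subseteq>J. card S = k \<and> (\<forall>i\<in>S. \<forall>j\<in>J - S. a j \<le> a i)"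
  proof (induction k)
    case 0
    show ?case by (intro exI[of _ "{}"]) auto
  next
    case (Suc k)
    then obtain S where S: "S \<subseteq> J" "card S = k" "\<forall>i\<in>S. \<forall>j\<in>J - S. a j \<le> a i"
      by auto
    have "J - S \<noteq> {}"
      using S(1,2) Suc.prems by auto
    then have "Max (a ` (J - S)) \<in> a ` (J - S)"
      using \<open>finite J\<close> by (intro Max_in) auto
    then obtain m where m: "m \<in> J - S" "a m = Max (a ` (J - S))"
      by auto
    have m_max: "a j \<le> a m" if "j \<in> J - S" for j
      using that m(2) \<open>finite J\<close> by simp
    have "card (insert m S) = Suc k"
      using S(1,2) m(1) finite_subset[OF S(1) \<open>finite J\<close>] by simp
    then show ?case
      using S m(1) m_max by (intro exI[of _ "insert m S"]) auto
  qed
  then show thesis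
    using that by blast
qed

text \<open>
  Strong duality.  When \<open>\<Gamma>\<close> is at least the number of indices, nothing has to be left out, and the
  threshold is \<open>0\<close>; otherwise it is the largest value left out.
\<close>

lemma ex_tight_dual:
  fixes a :: "'j \<Rightarrow> real"
  assumes "finite J" and a: "\<And>j. j \<in> J \<Longrightarrow> 0 \<le> a j"
  obtains S t where "S \<subseteq> J" "card S \<le> \<Gamma>" "0 \<le> t"
    "sum a S = real \<Gamma> * t + (\<Sum>j\<in>J. max 0 (a j - t))"
proof (cases "card J \<le> \<Gamma>")
  case True
  have "sum a J = real \<Gamma> * 0 + (\<Sum>j\<in>J. max 0 (a j - 0))"
    using a by (auto intro!: sum.cong simp: max_def)
  then show thesis
    using that[of J 0] True by simp
next
  case False
  then have "\<Gamma> \<le> card J" by simp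
  then obtain S where S: "S \<subseteq> J" "card S = \<Gamma>"
    and top: "\<And>i j. i \<in> S \<Longrightarrow> j \<in> J - S \<Longrightarrow> a j \<le> a i"
    using ex_largest_values_subset[OF \<open>finite J\<close>] by metis
  define t where "t = Max (a ` (J - S))"
  have "J - S \<noteq> {}"
    using S False by auto
  then have "t \<in> a ` (J - S)"
    unfolding t_def using \<open>finite J\<close> by (intro Max_in) auto
  then have "0 \<le> t" and inside: "\<And>i. i \<in> S \<Longrightarrow> t \<le> a i"
    using a top by auto
  have outside: "a j \<le> t" if "j \<in> J - S" for j
    unfolding t_def using that \<open>finite J\<close> by simp
  have "(\<Sum>j\<in>J. max 0 (a j - t)) = (\<Sum>j\<in>S. max 0 (a j - t))"
    using S(1) outside \<open>finite J\<close> by (intro sum.mono_neutral_right ballI) (simp_all add: max_absorb1)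
  also have "\<dots> = (\<Sum>j\<in>S. a j - t)"
    using inside by (intro sum.cong) auto
  also have "\<dots> = sum a S - real \<Gamma> * t"
    using S(2) by (simp add: sum_subtractf)
  finally show thesis
    using that[of S t] S \<open>0 \<le> t\<close> by simp
qed

lemma Max_sum_le_iff_dual:
  fixes a :: "'j \<Rightarrow> real"
  assumes "finite J" and a: "\<And>j. j \<in> J \<Longrightarrow> 0 \<le> a j"
  shows "(MAX S\<in>{S. S \<subseteq> J \<and> card S \<le> \<Gamma>}. sum a S) \<le> b \<longleftrightarrow>
    (\<exists>t p. 0 \<le> t \<and> p \<in> J \<rightarrow>\<^sub>E {0..} \<and> (\<forall>j\<in>J. a j \<le> t + p j) \<and> real \<Gamma> * t + sum p J \<le> b)"
    (is "?max \<le> b \<longleftrightarrow> ?dual")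
proof -
  let ?A = "{S. S \<subseteq> J \<and> card S \<le> \<Gamma>}"
  have "finite ?A" using \<open>finite J\<close> by simp
  moreover have "{} \<in> ?A" by simp
  then have "?A \<noteq> {}" by blast
  ultimately have max_le: "?max \<le> b \<longleftrightarrow> (\<forall>S\<in>?A. sum a S \<le> b)"
    by (subst Max_le_iff) auto
  show ?thesis
  proof
    assume "?max \<le> b"
    obtain S t where S: "S \<subseteq> J" "card S \<le> \<Gamma>" and "0 \<le> t"
      and tight: "sum a S = real \<Gamma> * t + (\<Sum>j\<in>J. max 0 (a j - t))"
      by (rule ex_tight_dual[OF assms])
    define p where "p = (\<lambda>j\<in>J. max 0 (a j - t))"
    have "real \<Gamma> * t + sum p J = sum a S"
      unfolding tight p_def by simp
    then have "real \<Gamma> * t + sum p J \<le> b"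
      using \<open>?max \<le> b\<close> S unfolding max_le by auto
    moreover have "p \<in> J \<rightarrow>\<^sub>E {0..}" "\<forall>j\<in>J. a j \<le> t + p j"
      by (auto simp: p_def)
    ultimately show ?dual
      using \<open>0 \<le> t\<close> by blast
  next
    assume ?dual
    then obtain t p where "0 \<le> t" and p: "p \<in> J \<rightarrow>\<^sub>E {0..}"
      and cover: "\<forall>j\<in>J. a j \<le> t + p j" and val: "real \<Gamma> * t + sum p J \<le> b"
      by blast
    have "sum a S \<le> b" if "S \<in> ?A" for S
    proof -
      have "sum a S \<le> real \<Gamma> * t + sum p J"
        using that p cover \<open>finite J\<close> \<open>0 \<le> t\<close> by (intro sum_le_dual) auto
      then show ?thesis using val by simp
    qed
    then show "?max \<le> b"
      unfolding max_le by blast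
  qed
qed

text \<open>
  A family of such bounds, one per facility, is certified by one pair of families of dual
  variables, because different facilities share no dual variable.
\<close>

lemma ball_Max_sum_le_iff_dual:
  fixes a :: "'i \<Rightarrow> 'j \<Rightarrow> real"
  assumes "finite J" and a: "\<And>i j. i \<in> I \<Longrightarrow> j \<in> J \<Longrightarrow> 0 \<le> a i j"
  shows "(\<forall>i\<in>I. (MAX S\<in>{S. S \<subseteq> J \<and> card S \<le> \<Gamma>}. sum (a i) S) \<le> b i) \<longleftrightarrow>
    (\<exists>\<rho> \<sigma>. \<rho> \<in> I \<rightarrow>\<^sub>E {0..} \<and> \<sigma> \<in> I \<times> J \<rightarrow>\<^sub>E {0..} \<and>
      (\<forall>j\<in>J. \<forall>i\<in>I. a i j \<le> \<rho> i + \<sigma> (i, j)) \<and>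
      (\<forall>i\<in>I. real \<Gamma> * \<rho> i + (\<Sum>j\<in>J. \<sigma> (i, j)) \<le> b i))"
    (is "?max \<longleftrightarrow> ?dual")
proof -
  have dual_i: "(MAX S\<in>{S. S \<subseteq> J \<and> card S \<le> \<Gamma>}. sum (a i) S) \<le> b i \<longleftrightarrow>
      (\<exists>t p. 0 \<le> t \<and> p \<in> J \<rightarrow>\<^sub>E {0..} \<and> (\<forall>j\<in>J. a i j \<le> t + p j) \<and>
        real \<Gamma> * t + sum p J \<le> b i)" if "i \<in> I" for i
    using a that by (intro Max_sum_le_iff_dual[OF \<open>finite J\<close>]) auto
  show ?thesis
  proof
    assume ?max
    then have "\<forall>i\<in>I. \<exists>t p. 0 \<le> t \<and> p \<in> J \<rightarrow>\<^sub>E {0..} \<and> (\<forall>j\<in>J. a i j \<le> t + p j) \<and>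
        real \<Gamma> * t + sum p J \<le> b i"
      using dual_i by simp
    then obtain t p where tp: "\<forall>i\<in>I. 0 \<le> t i \<and> p i \<in> J \<rightarrow>\<^sub>E {0..} \<and>
        (\<forall>j\<in>J. a i j \<le> t i + p i j) \<and> real \<Gamma> * t i + sum (p i) J \<le> b i"
      by metis
    have "p i j \<ge> 0" if "i \<in> I" "j \<in> J" for i j
      using tp that by fastforce
    then show ?dual
      using tp
      by (intro exI[of _ "restrict t I"] exI[of _ "restrict (\<lambda>(i, j). p i j) (I \<times> J)"]) auto
  next
    assume ?dual
    then obtain \<rho> \<sigma> where \<rho>: "\<rho> \<in> I \<rightarrow>\<^sub>E {0..}" and \<sigma>: "\<sigma> \<in> I \<times> J \<rightarrow>\<^sub>E {0..}"
      and cover: "\<forall>j\<in>J. \<forall>i\<in>I. a i j \<le> \<rho> i + \<sigma> (i, j)"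
      and val: "\<forall>i\<in>I. real \<Gamma> * \<rho> i + (\<Sum>j\<in>J. \<sigma> (i, j)) \<le> b i"
      by blast
    show ?max
    proof
      fix i assume "i \<in> I"
      have "0 \<le> \<rho> i \<and> (\<lambda>j\<in>J. \<sigma> (i, j)) \<in> J \<rightarrow>\<^sub>E {0..} \<and>
          (\<forall>j\<in>J. a i j \<le> \<rho> i + (\<lambda>j\<in>J. \<sigma> (i, j)) j) \<and>
          real \<Gamma> * \<rho> i + sum (\<lambda>j\<in>J. \<sigma> (i, j)) J \<le> b i"
        using \<rho> \<sigma> cover val \<open>i \<in> I\<close> by (auto simp: PiE_iff)
      then show "(MAX S\<in>{S. S \<subseteq> J \<and> card S \<le> \<Gamma>}. sum (a i) S) \<le> b i"
        unfolding dual_i[OF \<open>i \<in> I\<close>] by blast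
    qed
  qed
qed

lemma feasible_R_iff_feasible_E:
  fixes d dh :: "'j \<Rightarrow> real"
  assumes "finite J" and dh: "\<And>j. j \<in> J \<Longrightarrow> 0 \<le> dh j"
  shows "(x, y, v) \<in> feasible_R I J cov d dh D \<Gamma> \<longleftrightarrow>
    (\<exists>\<tau> \<rho> \<pi> \<sigma>. (x, y, v, \<tau>, \<rho>, \<pi>, \<sigma>) \<in> feasible_E I J cov d dh D \<Gamma>)"
proof (cases "x \<in> I \<times> J \<rightarrow>\<^sub>E {0..}")
  case False
  then show ?thesis
    by (auto simp: feasible_R_def feasible_E_def)
next
  case True
  then have nonneg: "0 \<le> dh j * x (i, j)" if "i \<in> I" "j \<in> J" for i j
    using dh that by (auto simp: PiE_iff)
  define load where "load = (\<lambda>i. \<Sum>j\<in>J. d j * x (i, j))"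
  define demand where "demand = (\<Sum>i\<in>I. \<Sum>j\<in>J. d j * x (i, j))"
  let ?A = "{S. S \<subseteq> J \<and> card S \<le> \<Gamma>}"
  have congestion:
    "(\<forall>i\<in>I. (MAX S\<in>?A. \<Sum>j\<in>S. dh j * x (i, j)) \<le> v i - load i) \<longleftrightarrow>
     (\<exists>\<rho> \<sigma>. \<rho> \<in> I \<rightarrow>\<^sub>E {0..} \<and> \<sigma> \<in> I \<times> J \<rightarrow>\<^sub>E {0..} \<and>
       (\<forall>j\<in>J. \<forall>i\<in>I. dh j * x (i, j) \<le> \<rho> i + \<sigma> (i, j)) \<and>
       (\<forall>i\<in>I. real \<Gamma> * \<rho> i + (\<Sum>j\<in>J. \<sigma> (i, j)) \<le> v i - load i))"
    using nonneg by (intro ball_Max_sum_le_iff_dual[OF \<open>finite J\<close>]) auto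
  \<comment> \<open>The deviations of one customer hit all facilities at once, so the facilities are summed
    first and duality is applied to the sums.\<close>
  have coverage:
    "(MAX S\<in>?A. \<Sum>i\<in>I. \<Sum>j\<in>S. dh j * x (i, j)) \<le> demand - D \<longleftrightarrow>
     (\<exists>\<tau> \<pi>. 0 \<le> \<tau> \<and> \<pi> \<in> J \<rightarrow>\<^sub>E {0..} \<and>
       (\<forall>j\<in>J. (\<Sum>i\<in>I. dh j * x (i, j)) \<le> \<tau> + \<pi> j) \<and>
       real \<Gamma> * \<tau> + sum \<pi> J \<le> demand - D)"
    unfolding sum.swap[of _ _ I]
    using nonneg by (intro Max_sum_le_iff_dual[OF \<open>finite J\<close>] sum_nonneg) auto
  let ?common = "y \<in> I \<rightarrow>\<^sub>E {0, 1} \<and> v \<in> I \<rightarrow>\<^sub>E {0..} \<and>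
    (\<forall>j\<in>J. (\<Sum>i\<in>I. x (i, j)) \<le> 1) \<and> (\<forall>j\<in>J. \<forall>i\<in>cov j. x (i, j) \<le> y i)"
  have "(x, y, v) \<in> feasible_R I J cov d dh D \<Gamma> \<longleftrightarrow> ?common \<and>
      (\<forall>i\<in>I. (MAX S\<in>?A. \<Sum>j\<in>S. dh j * x (i, j)) \<le> v i - load i) \<and>
      (MAX S\<in>?A. \<Sum>i\<in>I. \<Sum>j\<in>S. dh j * x (i, j)) \<le> demand - D"
    using True unfolding feasible_R_def load_def demand_def
    by (simp add: le_diff_eq algebra_simps) blast
  also have "\<dots> \<longleftrightarrow> (\<exists>\<tau> \<rho> \<pi> \<sigma>. (x, y, v, \<tau>, \<rho>, \<pi>, \<sigma>) \<in> feasible_E I J cov d dh D \<Gamma>)"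
  proof -
    have E_iff: "(x, y, v, \<tau>, \<rho>, \<pi>, \<sigma>) \<in> feasible_E I J cov d dh D \<Gamma> \<longleftrightarrow> ?common \<and>
        (\<rho> \<in> I \<rightarrow>\<^sub>E {0..} \<and> \<sigma> \<in> I \<times> J \<rightarrow>\<^sub>E {0..} \<and>
         (\<forall>j\<in>J. \<forall>i\<in>I. dh j * x (i, j) \<le> \<rho> i + \<sigma> (i, j)) \<and>
         (\<forall>i\<in>I. real \<Gamma> * \<rho> i + (\<Sum>j\<in>J. \<sigma> (i, j)) \<le> v i - load i)) \<and>
        (0 \<le> \<tau> \<and> \<pi> \<in> J \<rightarrow>\<^sub>E {0..} \<and>
         (\<forall>j\<in>J. (\<Sum>i\<in>I. dh j * x (i, j)) \<le> \<tau> + \<pi> j) \<and>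
         real \<Gamma> * \<tau> + sum \<pi> J \<le> demand - D)" for \<tau> \<rho> \<pi> \<sigma>
      using True unfolding feasible_E_def load_def demand_def
      by (simp add: le_diff_eq algebra_simps) blast
    show ?thesis
      unfolding congestion coverage E_iff by blast
  qed
  finally show ?thesis .
qed

lemma optimal_value_image:
  "optimal_value g (p ` X) = optimal_value (g \<circ> p) X"
  by (simp add: optimal_value_def image_comp comp_def)

lemma is_arg_min_image_iff:
  "is_arg_min g (\<lambda>z. z \<in> p ` X) z \<longleftrightarrow> (\<exists>w. p w = z \<and> is_arg_min (g \<circ> p) (\<lambda>w. w \<in> X) w)"
  by (auto simp: is_arg_min_def)

theorem theorem2p1:
  fixes I :: "'i set" and J :: "'j set" and cov :: "'j \<Rightarrow> 'i set"
    and f :: "'i \<Rightarrow> real" and d dh :: "'j \<Rightarrow> real" and D :: real and \<Gamma> :: nat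
    and F :: "'i \<Rightarrow> real \<Rightarrow> real"
  assumes "finite I" and "finite J"
    and "\<And>j. j \<in> J \<Longrightarrow> cov j \<subseteq> I"
    and "\<And>i. i \<in> I \<Longrightarrow> 0 \<le> f i"
    and "\<And>j. j \<in> J \<Longrightarrow> 0 \<le> d j"
    and "\<And>j. j \<in> J \<Longrightarrow> 0 \<le> dh j"
    and "0 < D" and "D \<le> (\<Sum>j\<in>J. d j)"
    and "\<Gamma> \<le> card J"
    and "\<And>i t. i \<in> I \<Longrightarrow> 0 \<le> F i t"
    and "\<And>i. i \<in> I \<Longrightarrow> convex_on UNIV (F i)"
    and "\<And>i. i \<in> I \<Longrightarrow> mono (F i)"
  shows "(\<forall>x y v. (x, y, v) \<in> feasible_R I J cov d dh D \<Gamma> \<longleftrightarrow>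
            (\<exists>\<tau> \<rho> \<pi> \<sigma>. (x, y, v, \<tau>, \<rho>, \<pi>, \<sigma>) \<in> feasible_E I J cov d dh D \<Gamma>))
    \<and> (\<forall>(x :: 'i \<times> 'j \<Rightarrow> real) (x' :: 'i \<times> 'j \<Rightarrow> real) y v \<tau> \<rho> (\<pi> :: 'j \<Rightarrow> real) \<sigma>.
          objective_R I f F (x, y, v) = objective_E I f F (x', y, v, \<tau>, \<rho>, \<pi>, \<sigma>))
    \<and> optimal_value (objective_R I f F) (feasible_R I J cov d dh D \<Gamma>)
        = optimal_value (objective_E I f F) (feasible_E I J cov d dh D \<Gamma>)
    \<and> (\<forall>x y v.
          is_arg_min (objective_R I f F) (\<lambda>z. z \<in> feasible_R I J cov d dh D \<Gamma>) (x, y, v) \<longleftrightarrow>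
          (\<exists>\<tau> \<rho> \<pi> \<sigma>. is_arg_min (objective_E I f F) (\<lambda>z. z \<in> feasible_E I J cov d dh D \<Gamma>)
             (x, y, v, \<tau>, \<rho>, \<pi>, \<sigma>)))"
proof -
  let ?R = "feasible_R I J cov d dh D \<Gamma>" and ?E = "feasible_E I J cov d dh D \<Gamma>"
  define primal :: "('i \<times> 'j \<Rightarrow> real) \<times> ('i \<Rightarrow> real) \<times> ('i \<Rightarrow> real) \<times>
      real \<times> ('i \<Rightarrow> real) \<times> ('j \<Rightarrow> real) \<times> ('i \<times> 'j \<Rightarrow> real) \<Rightarrow> _"
    where "primal = (\<lambda>(x, y, v, \<tau>, \<rho>, \<pi>, \<sigma>). (x, y, v))"
  have feasible: "(x, y, v) \<in> ?R \<longleftrightarrow> (\<exists>\<tau> \<rho> \<pi> \<sigma>. (x, y, v, \<tau>, \<rho>, \<pi>, \<sigma>) \<in> ?E)" for x y v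
    using assms by (intro feasible_R_iff_feasible_E) auto
  have R_eq: "?R = primal ` ?E"
  proof (intro set_eqI)
    fix z :: "('i \<times> 'j \<Rightarrow> real) \<times> ('i \<Rightarrow> real) \<times> ('i \<Rightarrow> real)"
    obtain x y v where z: "z = (x, y, v)" by (rule prod_cases3)
    have "z \<in> primal ` ?E \<longleftrightarrow> (\<exists>\<tau> \<rho> \<pi> \<sigma>. (x, y, v, \<tau>, \<rho>, \<pi>, \<sigma>) \<in> ?E)"
      unfolding z primal_def by (force simp: image_iff)
    then show "z \<in> ?R \<longleftrightarrow> z \<in> primal ` ?E"
      unfolding z feasible by blast
  qed
  have obj_eq: "objective_E I f F = objective_R I f F \<circ> primal"
    by (auto simp: fun_eq_iff objective_E_def objective_R_def primal_def)
  have arg_min: "is_arg_min (objective_R I f F) (\<lambda>z. z \<in> ?R) (x, y, v) \<longleftrightarrow>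
      (\<exists>\<tau> \<rho> \<pi> \<sigma>. is_arg_min (objective_E I f F) (\<lambda>z. z \<in> ?E) (x, y, v, \<tau>, \<rho>, \<pi>, \<sigma>))" for x y v
    unfolding R_eq obj_eq is_arg_min_image_iff by (auto simp: primal_def)
  have value_eq: "optimal_value (objective_R I f F) ?R = optimal_value (objective_E I f F) ?E"
    unfolding R_eq obj_eq by (rule optimal_value_image)
  have objective: "objective_R I f F (x, y, v) = objective_E I f F (x', y, v, \<tau>, \<rho>, \<pi>, \<sigma>)"
    for x x' :: "'i \<times> 'j \<Rightarrow> real" and y v \<tau> \<rho> and \<pi> :: "'j \<Rightarrow> real" and \<sigma>
    by (simp add: objective_R_def objective_E_def)
  show ?thesis
    using feasible objective value_eq arg_min by blast
qed

end
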